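(* There exists a weight function $\omega$ in the sense of Braun–Meise–Taylor such that $\mathcal{E}^{\{\omega\}}$ is quasianalytic and $$\mathcal{E}^{\{\omega\}}\nsubseteq\mathcal{E}^{\{\mathbf{M}\}}$$ for any semiregular weight sequence $\mathbf{M}$.
   Context: Weight sequence: $\mathbf{M}=(M_k)_{k\ge 0}$, $M_k>0$, $M_0=1$, $M_k^{1/k}\to\infty$, $M_k^2\le M_{k-1}M_{k+1}$ for $k\ge1$. It is semiregular if $M_k^{1/k}/k\to\infty$ and there is $Q>0$ with $M_{k+1}\le Q^{k+1}M_k$ for all $k$. For open $\Omega\subseteq\mathbb{R}^n$, $\mathcal{E}^{\{\mathbf{M}\}}(\Omega)$ is the set of $f\in\mathcal{C}^\infty(\Omega)$ such that for each compact $K\subseteq\Omega$ there are $C,h>0$ with $\sup_K|D^\alpha f|\le Ch^{|\alpha|}M_{|\alpha|}$ for all $\alpha$. Weight function (Braun–Meise–Taylor): non-decreasing continuous $\omega:[0,\infty)\to[0,\infty)$ with $\omega=0$ on $[0,1]$, $\omega(2t)=O(\omega(t))$, $\log t=o(\omega(t))$ as $t\to\infty$, and $\varphi_\omega(t)=\omega(e^t)$ convex. Put $\varphi^*_\omega(t)=\sup_{s\ge0}(st-\varphi_\omega(s))$. $\mathcal{E}^{\{\omega\}}(\Omega)$ is the set of $f\in\mathcal{C}^\infty(\Omega)$ such that for each compact $K\subseteq\Omega$ there are $C,h>0$ with $\sup_K|D^\alpha f|\le C\exp(\tfrac1h\varphi^*_\omega(h|\alpha|))$ for all $\alpha$. $\mathcal{E}^{\{\ast\}}$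 denotes the corresponding subsheaf of the sheaf of smooth functions; it is quasianalytic if it contains no nonzero compactly supported function, i.e. $\mathcal{E}^{\{\ast\}}(\Omega)\cap\mathcal{C}^\infty_0(\Omega)=\{0\}$. *)

theory Defs
  imports "HOL-Analysis.Analysis" "HOL-Library.Landau_Symbols"
begin

text \<open>
  \<open>\<real>\<^sup>n\<close> is the library's \<^const>\<open>Euclidean_space\<close> \<open>n\<close>, whose points are the \<open>x :: nat \<Rightarrow> real\<close> with
  \<open>x i = 0\<close> for \<open>i \<ge> n\<close>; this keeps \<open>n\<close> a natural number, so that it can be quantified over after \<open>\<omega>\<close>.
  A function on an open set \<open>\<Omega>\<close> is a total function of which only the values on \<open>\<Omega>\<close> matter:
  all the notions below depend on those values alone.
\<close>

type_synonym pt = "nat \<Rightarrow> real"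

definition partial_deriv :: "nat \<Rightarrow> (pt \<Rightarrow> complex) \<Rightarrow> pt \<Rightarrow> complex" where
  "partial_deriv i f x = vector_derivative (\<lambda>t. f (x(i := t))) (at (x i))"

text \<open>
  \<open>f \<in> C\<^sup>\<infinity>(\<Omega>)\<close>: all iterated partial derivatives, in any order, exist and are continuous on \<open>\<Omega>\<close>.
\<close>

definition smooth_on_open :: "nat \<Rightarrow> pt set \<Rightarrow> (pt \<Rightarrow> complex) \<Rightarrow> bool" where
  "smooth_on_open n \<Omega> f \<longleftrightarrow>
     (\<forall>is. set is \<subseteq> {..<n} \<longrightarrow>
        continuous_map (subtopology (Euclidean_space n) \<Omega>) euclidean (foldr partial_deriv is f) \<and>
        (\<forall>i<n. \<forall>x\<in>\<Omega>. (\<lambda>t. foldr partial_deriv is f (x(i := t))) differentiable (at (x i))))"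

text \<open>
  Multi-indices are functions \<open>\<alpha> :: nat \<Rightarrow> nat\<close> of which only the first \<open>n\<close> values are used.
\<close>

definition mi_deriv :: "nat \<Rightarrow> (nat \<Rightarrow> nat) \<Rightarrow> (pt \<Rightarrow> complex) \<Rightarrow> pt \<Rightarrow> complex" where
  "mi_deriv n \<alpha> f = foldr (\<lambda>i. partial_deriv i ^^ \<alpha> i) [0..<n] f"

definition mi_order :: "nat \<Rightarrow> (nat \<Rightarrow> nat) \<Rightarrow> nat" where
  "mi_order n \<alpha> = (\<Sum>i<n. \<alpha> i)"

definition roumieu_class ::
  "nat \<Rightarrow> (real \<Rightarrow> nat \<Rightarrow> real) \<Rightarrow> pt set \<Rightarrow> (pt \<Rightarrow> complex) set" where
  "roumieu_class n B \<Omega> = {f. smooth_on_open n \<Omega> f \<and>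
     (\<forall>K. compactin (Euclidean_space n) K \<and> K \<subseteq> \<Omega> \<longrightarrow>
        (\<exists>C>0. \<exists>h>0. \<forall>\<alpha>. \<forall>x\<in>K. norm (mi_deriv n \<alpha> f x) \<le> C * B h (mi_order n \<alpha>)))}"

definition weight_sequence :: "(nat \<Rightarrow> real) \<Rightarrow> bool" where
  "weight_sequence M \<longleftrightarrow>
     (\<forall>k. M k > 0) \<and> M 0 = 1 \<and>
     filterlim (\<lambda>k. root k (M k)) at_top sequentially \<and>
     (\<forall>k\<ge>1. (M k)\<^sup>2 \<le> M (k - 1) * M (k + 1))"

definition semiregular :: "(nat \<Rightarrow> real) \<Rightarrow> bool" where
  "semiregular M \<longleftrightarrow>
     filterlim (\<lambda>k. root k (M k) / real k) at_top sequentially \<and>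
     (\<exists>Q>0. \<forall>k. M (k + 1) \<le> Q ^ (k + 1) * M k)"

definition E_seq :: "nat \<Rightarrow> (nat \<Rightarrow> real) \<Rightarrow> pt set \<Rightarrow> (pt \<Rightarrow> complex) set" where
  "E_seq n M = roumieu_class n (\<lambda>h k. h ^ k * M k)"

text \<open>
  Only the values of \<open>\<omega>\<close> on \<open>[0,\<infinity>)\<close> matter.
\<close>

definition weight_function :: "(real \<Rightarrow> real) \<Rightarrow> bool" where
  "weight_function \<omega> \<longleftrightarrow>
     mono_on {0..} \<omega> \<and> continuous_on {0..} \<omega> \<and> (\<forall>t\<ge>0. \<omega> t \<ge> 0) \<and>
     (\<forall>t\<in>{0..1}. \<omega> t = 0) \<and>
     (\<lambda>t. \<omega> (2 * t)) \<in> O[at_top](\<omega>) \<and>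
     ln \<in> o[at_top](\<omega>) \<and>
     convex_on UNIV (\<lambda>t. \<omega> (exp t))"

text \<open>
  For a weight function and \<open>t \<ge> 0\<close> the supremum is over a set that is bounded above, because
  \<open>log t = o(\<omega>(t))\<close>; so the supremum in \<^typ>\<open>real\<close> is the true one.
\<close>

definition conj_phi :: "(real \<Rightarrow> real) \<Rightarrow> real \<Rightarrow> real" where
  "conj_phi \<omega> t = (SUP s\<in>{0..}. s * t - \<omega> (exp s))"

definition E_fun :: "nat \<Rightarrow> (real \<Rightarrow> real) \<Rightarrow> pt set \<Rightarrow> (pt \<Rightarrow> complex) set" where
  "E_fun n \<omega> = roumieu_class n (\<lambda>h k. exp (1 / h * conj_phi \<omega> (h * real k)))"

definition compactly_supported :: "nat \<Rightarrow> pt set \<Rightarrow> (pt \<Rightarrow> complex) \<Rightarrow> bool" where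
  "compactly_supported n \<Omega> f \<longleftrightarrow>
     compactin (Euclidean_space n)
       (subtopology (Euclidean_space n) \<Omega> closure_of {x \<in> \<Omega>. f x \<noteq> 0})"

text \<open>
  The next two notions concern subsheaves \<open>F\<close>, \<open>G\<close> of the sheaf of smooth functions on \<open>\<real>\<^sup>n\<close>,
  given by their sections over each open set.
\<close>

definition quasianalytic :: "nat \<Rightarrow> (pt set \<Rightarrow> (pt \<Rightarrow> complex) set) \<Rightarrow> bool" where
  "quasianalytic n F \<longleftrightarrow>
     (\<forall>\<Omega>. openin (Euclidean_space n) \<Omega> \<longrightarrow>
        (\<forall>f\<in>F \<Omega>. compactly_supported n \<Omega> f \<longrightarrow> (\<forall>x\<in>\<Omega>. f x = 0)))"

definition subsheaf :: "nat \<Rightarrow> (pt set \<Rightarrow> (pt \<Rightarrow> complex) set) \<Rightarrow> (pt set \<Rightarrow> (pt \<Rightarrow> complex) set) \<Rightarrow> bool" where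
  "subsheaf n F G \<longleftrightarrow> (\<forall>\<Omega>. openin (Euclidean_space n) \<Omega> \<longrightarrow> F \<Omega> \<subseteq> G \<Omega>)"

end

theory Submission
  imports Defs "HOL-Real_Asymp.Real_Asymp"
begin

text \<open>
  The weight is \<open>\<omega> = \<phi> \<circ> ln\<close> for a convex \<open>\<phi>\<close> that alternates between linear stretches and stretches
  growing like \<open>exp (2 s)\<close>. With nodes \<open>a\<^sub>j\<close> that increase very fast, it satisfies
  \<^item> \<open>\<phi> s \<ge> 2 exp (4 a\<^sub>j) (s - 3 a\<^sub>j)\<close> for all \<open>s\<close>: a supporting line at \<open>3 a\<^sub>j\<close> of slope much larger
    than \<open>exp (3 a\<^sub>j)\<close>. Hence for every \<open>h\<close> the bound \<open>exp (\<phi>\<^sup>* (h k) / h)\<close> on the \<open>k\<close>-th derivatives is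
    \<open>o(\<epsilon>\<^sup>k k!)\<close> for all \<open>\<epsilon> > 0\<close> along a subsequence of \<open>k\<close>, and Taylor's formula alone forces a function
    that is flat at a point to vanish near it; no Denjoy--Carleman theorem is needed.
  \<^item> \<open>\<phi> a\<^sub>j \<le> 4 a\<^sub>j powr (3/2)\<close>, which is \<open>o(a\<^sub>j\<^sup>2)\<close>. Therefore
    \<open>f x = (\<Sum>j. 2\<^bsup>-j\<^esup> exp (- \<phi> a\<^sub>j) exp (\<i> exp a\<^sub>j x\<^sub>0))\<close> belongs to the class of \<open>\<omega>\<close>, while its derivatives
    at \<open>0\<close> exceed \<open>C h\<^sup>k Q\<^bsup>k\<^sup>2\<^esup>\<close>, which dominates \<open>C h\<^sup>k M\<^sub>k\<close> for semiregular \<open>M\<close>; the choice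
    \<open>k \<approx> a\<^sub>j powr (3/4)\<close> exhibits this.
\<close>

section \<open>The exponential continued by its tangent at 0\<close>

definition trunc_exp :: "real \<Rightarrow> real" where
  "trunc_exp u = exp (min u 0) + max u 0"

text \<open>\<open>exp (min u 0)\<close> is the derivative of \<open>trunc_exp\<close> at
  \<open>u\<close>: the tangent inequality behind convexity.\<close>

lemma trunc_exp_support: "trunc_exp u + exp (min u 0) * (v - u) \<le> trunc_exp v"
proof (cases "u \<ge> 0")
  case True
  then show ?thesis
    using exp_ge_add_one_self[of v] by (cases "v \<ge> 0") (auto simp: trunc_exp_def)
next
  case u: False
  show ?thesis
  proof (cases "v \<ge> 0")
    case True
    have "exp u * (1 - u) \<le> exp u * exp (- u)"
      using exp_ge_add_one_self[of "- u"] by (intro mult_left_mono) auto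
    also have "\<dots> = 1" by (simp flip: exp_add)
    finally have "exp u * (1 - u) \<le> 1" .
    moreover have "exp u * v \<le> v"
      using mult_right_mono[of "exp u" 1 v] True u by auto
    ultimately show ?thesis using u True by (simp add: trunc_exp_def algebra_simps)
  next
    case False
    have "exp u * (1 + (v - u)) \<le> exp u * exp (v - u)"
      using exp_ge_add_one_self[of "v - u"] by (intro mult_left_mono) auto
    also have "\<dots> = exp v" by (simp flip: exp_add)
    finally show ?thesis using u False by (simp add: trunc_exp_def algebra_simps)
  qed
qed

lemma trunc_exp_pos: "trunc_exp u > 0"
  by (simp add: trunc_exp_def add_pos_nonneg)

lemma trunc_exp_mono: "u \<le> v \<Longrightarrow> trunc_exp u \<le> trunc_exp v"
  by (auto simp: trunc_exp_def intro!: add_mono)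

lemma trunc_exp_le_exp: "trunc_exp u \<le> exp u"
  using exp_ge_add_one_self[of u] by (cases "u \<ge> 0") (auto simp: trunc_exp_def)

lemma trunc_exp_ge: "1 + u \<le> trunc_exp u"
  using exp_ge_add_one_self[of u] by (cases "u \<ge> 0") (auto simp: trunc_exp_def)

text \<open>Source of the doubling condition on \<omega>. On the linear branch it rests on 3 + u
  \<le> 3 (1 + u).\<close>

lemma trunc_exp_shift: "trunc_exp (u + 2) \<le> exp 2 * trunc_exp u"
proof (cases "u \<ge> 0")
  case True
  have "3 \<le> exp (2::real)" using exp_ge_add_one_self[of 2] by simp
  then have "3 * (1 + u) \<le> exp 2 * (1 + u)" using True by (intro mult_right_mono) auto
  with True show ?thesis by (simp add: trunc_exp_def)
next
  case False
  then show ?thesis using trunc_exp_le_exp[of "u + 2"]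
    by (simp add: trunc_exp_def exp_add mult.commute)
qed

section \<open>Nodes and the weight function\<close>

text \<open>The factor 8 makes \<open>exp (4 * node j)\<close>, the scale of \<open>piece j\<close>,
  the square root of the next node; hence the exponent 3/2 in
  \<open>osc_phi_node_le\<close>.\<close>

primrec node :: "nat \<Rightarrow> real" where
  "node 0 = 1"
| "node (Suc j) = exp (8 * node j)"

lemma node_ge: "node j \<ge> real j + 1"
proof (induction j)
  case (Suc j)
  have "1 + 8 * node j \<le> node (Suc j)"
    unfolding node.simps by (rule exp_ge_add_one_self)
  with Suc show ?case unfolding of_nat_Suc by linarith
qed simp

lemma node_ge_1: "node j \<ge> 1"
  using node_ge[of j] by simp

lemma node_mono: "i \<le> j \<Longrightarrow> node i \<le> node j"
proof (rule lift_Suc_mono_le[of node])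
  fix n
  show "node n \<le> node (Suc n)"
    using exp_ge_add_one_self[of "8 * node n"] node_ge_1[of n] unfolding node.simps by linarith
qed

lemma filterlim_node: "filterlim node at_top sequentially"
proof (rule filterlim_at_top_mono)
  show "filterlim real at_top sequentially" by (rule filterlim_real_sequentially)
  show "\<forall>\<^sub>F j in sequentially. real j \<le> node j"
    using node_ge by (intro always_eventually) (smt (verit))
qed

text \<open>\<open>piece j\<close> is \<open>exp (2 (s - a\<^sub>j))\<close> up to \<open>s = 3 a\<^sub>j\<close> and continues along its tangent; it is at most 1
  up to \<open>a\<^sub>j\<close>, so the pieces with index \<open>\<ge> j\<close> do not disturb the linear stretch ending at \<open>a\<^sub>j\<close>.\<close>

definition piece :: "nat \<Rightarrow> real \<Rightarrow> real" where
  "piece j s = exp (4 * node j) * trunc_exp (2 * (s - 3 * node j))"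

definition sup_piece :: "real \<Rightarrow> real" where
  "sup_piece s = (SUP j. piece j s)"

text \<open>All pieces are at most 1 for \<open>s \<le> 0\<close>, so subtracting 1 and truncating
  makes \<omega> vanish on [0,1].\<close>

definition osc_phi :: "real \<Rightarrow> real" where
  "osc_phi s = max 0 (sup_piece s - 1)"

definition osc_weight :: "real \<Rightarrow> real" where
  "osc_weight t = (if t \<le> 1 then 0 else osc_phi (ln t))"

lemma piece_le_exp: "piece j s \<le> exp (2 * (s - node j))"
proof -
  have "piece j s \<le> exp (4 * node j) * exp (2 * (s - 3 * node j))"
    unfolding piece_def by (intro mult_left_mono trunc_exp_le_exp) auto
  also have "\<dots> = exp (2 * (s - node j))" by (simp flip: exp_add)
  finally show ?thesis .
qed

lemma bdd_above_piece: "bdd_above (range (\<lambda>j. piece j s))"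
proof (rule bdd_aboveI2)
  fix j
  show "piece j s \<le> exp (2 * s)"
    using piece_le_exp[of j s] node_ge_1[of j] by (smt (verit) exp_le_cancel_iff)
qed

lemma piece_le_sup: "piece j s \<le> sup_piece s"
  unfolding sup_piece_def by (rule cSUP_upper[OF UNIV_I bdd_above_piece])

lemma sup_piece_least: "(\<And>j. piece j s \<le> B) \<Longrightarrow> sup_piece s \<le> B"
  unfolding sup_piece_def by (rule cSUP_least) auto

lemma sup_piece_mono: "s \<le> t \<Longrightarrow> sup_piece s \<le> sup_piece t"
proof (rule sup_piece_least)
  fix j
  assume "s \<le> t"
  then have "piece j s \<le> piece j t"
    unfolding piece_def by (intro mult_left_mono trunc_exp_mono) auto
  then show "piece j s \<le> sup_piece t" using piece_le_sup by (rule order.trans)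
qed

lemma osc_phi_mono: "s \<le> t \<Longrightarrow> osc_phi s \<le> osc_phi t"
  using sup_piece_mono[of s t] by (auto simp: osc_phi_def)

lemma osc_phi_nonneg: "osc_phi s \<ge> 0"
  by (simp add: osc_phi_def)

lemma osc_phi_nonpos_arg:
  assumes "s \<le> 0" shows "osc_phi s = 0"
proof -
  have "sup_piece s \<le> 1"
  proof (rule sup_piece_least)
    fix j
    show "piece j s \<le> 1"
      using piece_le_exp[of j s] node_ge_1[of j] assms
      by (smt (verit) exp_le_one_iff)
  qed
  then show ?thesis by (simp add: osc_phi_def)
qed

lemma osc_weight_exp: "osc_weight (exp s) = osc_phi s"
  by (simp add: osc_weight_def osc_phi_nonpos_arg)

text \<open>The tangent of \<open>piece j\<close> at \<open>3 * node j\<close>, lowered: its value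
  \<open>exp (4 * node j)\<close> there pays for the 1 subtracted in \<open>osc_phi\<close>.\<close>

lemma osc_phi_ge: "2 * exp (4 * node j) * (s - 3 * node j) \<le> osc_phi s"
proof -
  have "exp (4 * node j) * (1 + 2 * (s - 3 * node j)) \<le> piece j s"
    unfolding piece_def by (intro mult_left_mono trunc_exp_ge) auto
  moreover have "1 \<le> exp (4 * node j)" using node_ge_1[of j] one_le_exp_iff[of "4 * node j"] by linarith
  ultimately have "1 + 2 * exp (4 * node j) * (s - 3 * node j) \<le> piece j s"
    unfolding ring_distribs by linarith
  also have "\<dots> \<le> sup_piece s" by (rule piece_le_sup)
  finally show ?thesis by (simp add: osc_phi_def)
qed

text \<open>At \<open>node j\<close> the pieces from index \<open>j\<close> on are at most 1. An
  earlier one has scale at most \<open>node j powr (1/2)\<close>, times a truncated exponential of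
  at most \<open>1 + 2 * node j\<close>.\<close>

lemma osc_phi_node_le: "osc_phi (node j) \<le> 4 * node j powr (3/2)"
proof -
  have ge1: "1 \<le> node j powr (3/2)" using node_ge_1 by (simp add: ge_one_powr_ge_zero)
  have "sup_piece (node j) \<le> 1 + 3 * node j powr (3/2)"
  proof (rule sup_piece_least)
    fix i
    show "piece i (node j) \<le> 1 + 3 * node j powr (3/2)"
    proof (cases "i < j")
      case False
      then have "2 * (node j - node i) \<le> 0" using node_mono[of j i] by simp
      then have "piece i (node j) \<le> exp 0"
        by (intro order.trans[OF piece_le_exp]) simp
      then show ?thesis using ge1 by simp
    next
      case True
      then obtain l where l: "j = Suc l" "i \<le> l" by (cases j) auto
      have "exp (4 * node i) \<le> exp (4 * node l)" using node_mono[OF l(2)] by simp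
      also have "\<dots> = node j powr (1/2)" by (simp add: l powr_def)
      finally have 1: "exp (4 * node i) \<le> node j powr (1/2)" .
      have "trunc_exp (2 * (node j - 3 * node i)) \<le> trunc_exp (2 * node j)"
        using node_ge_1[of i] by (intro trunc_exp_mono) auto
      also have "\<dots> = 1 + 2 * node j" using node_ge_1[of j] by (simp add: trunc_exp_def)
      also have "\<dots> \<le> 3 * node j" using node_ge_1[of j] by simp
      finally have "piece i (node j) \<le> node j powr (1/2) * (3 * node j)"
        unfolding piece_def using 1 trunc_exp_pos by (intro mult_mono) (auto intro: less_imp_le)
      also have "\<dots> = 3 * node j powr (3/2)"
        using node_ge_1[of j] powr_add[of "node j" "1/2" 1] by simp
      finally show ?thesis by simp
    qed
  qed
  with ge1 show ?thesis by (auto simp: osc_phi_def)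
qed

section \<open>The axioms of a weight function\<close>

lemma convex_on_trunc_exp: "convex_on UNIV trunc_exp"
proof (rule convex_onI)
  fix t x y :: real
  assume t: "0 < t" "t < 1"
  define w where "w = (1 - t) *\<^sub>R x + t *\<^sub>R y"
  define d where "d = exp (min w 0)"
  have "(1 - t) * (trunc_exp w + d * (x - w)) + t * (trunc_exp w + d * (y - w))
        \<le> (1 - t) * trunc_exp x + t * trunc_exp y"
    using t trunc_exp_support[of w] unfolding d_def
    by (intro add_mono mult_left_mono) auto
  moreover have "(1 - t) * (trunc_exp w + d * (x - w)) + t * (trunc_exp w + d * (y - w))
        = trunc_exp w + d * ((1 - t) * x + t * y - w)"
    by (simp add: algebra_simps)
  ultimately show "trunc_exp ((1 - t) *\<^sub>R x + t *\<^sub>R y) \<le> (1 - t) * trunc_exp x + t * trunc_exp y"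
    by (simp add: w_def)
qed auto

lemma piece_convex:
  assumes "0 \<le> u" "0 \<le> v" "u + v = 1"
  shows "piece j (u * x + v * y) \<le> u * piece j x + v * piece j y"
proof -
  have *: "2 * (u * x + v * y - 3 * node j) = u * (2 * (x - 3 * node j)) + v * (2 * (y - 3 * node j))"
  proof -
    have "u = 1 - v" using assms by simp
    then show ?thesis by (simp only:) (simp add: algebra_simps)
  qed
  have "trunc_exp (2 * (u * x + v * y - 3 * node j))
      \<le> u * trunc_exp (2 * (x - 3 * node j)) + v * trunc_exp (2 * (y - 3 * node j))"
    unfolding * using convex_on_trunc_exp assms unfolding convex_on_def by auto
  then have "piece j (u * x + v * y) \<le> exp (4 * node j) *
     (u * trunc_exp (2 * (x - 3 * node j)) + v * trunc_exp (2 * (y - 3 * node j)))"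
    unfolding piece_def by (intro mult_left_mono) auto
  then show ?thesis by (simp add: piece_def algebra_simps)
qed

lemma convex_on_osc_phi: "convex_on UNIV osc_phi"
  unfolding convex_on_def
proof (intro conjI ballI allI impI)
  fix x y u v :: real
  assume uv: "0 \<le> u" "0 \<le> v" "u + v = 1"
  have "sup_piece (u *\<^sub>R x + v *\<^sub>R y) \<le> u * sup_piece x + v * sup_piece y"
  proof (rule sup_piece_least)
    fix j
    have "piece j (u *\<^sub>R x + v *\<^sub>R y) \<le> u * piece j x + v * piece j y"
      using piece_convex[OF uv] by simp
    also have "\<dots> \<le> u * sup_piece x + v * sup_piece y"
      using uv by (intro add_mono mult_left_mono piece_le_sup)
    finally show "piece j (u *\<^sub>R x + v *\<^sub>R y) \<le> u * sup_piece x + v * sup_piece y" .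
  qed
  also have "\<dots> \<le> u * (osc_phi x + 1) + v * (osc_phi y + 1)"
    using uv by (intro add_mono mult_left_mono) (auto simp: osc_phi_def)
  also have "\<dots> = u * osc_phi x + v * osc_phi y + 1"
    using uv by (simp add: algebra_simps)
  finally show "osc_phi (u *\<^sub>R x + v *\<^sub>R y) \<le> u * osc_phi x + v * osc_phi y"
    using uv osc_phi_nonneg[of x] osc_phi_nonneg[of y]
    by (subst osc_phi_def) simp
qed auto

lemma osc_phi_shift: "osc_phi (s + 1) \<le> exp 2 * (osc_phi s + 1)"
proof -
  have "sup_piece (s + 1) \<le> exp 2 * sup_piece s"
  proof (rule sup_piece_least)
    fix j
    have "trunc_exp (2 * (s + 1 - 3 * node j)) = trunc_exp (2 * (s - 3 * node j) + 2)"
      by (simp add: algebra_simps)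
    then have "piece j (s + 1) \<le> exp (4 * node j) * (exp 2 * trunc_exp (2 * (s - 3 * node j)))"
      unfolding piece_def using trunc_exp_shift by (intro mult_left_mono) auto
    also have "\<dots> = exp 2 * piece j s" by (simp add: piece_def)
    also have "\<dots> \<le> exp 2 * sup_piece s" by (intro mult_left_mono piece_le_sup) auto
    finally show "piece j (s + 1) \<le> exp 2 * sup_piece s" .
  qed
  also have "\<dots> \<le> exp 2 * (osc_phi s + 1)" by (intro mult_left_mono) (auto simp: osc_phi_def)
  finally have "sup_piece (s + 1) \<le> exp 2 * (osc_phi s + 1)" .
  then show ?thesis using osc_phi_nonneg[of s] by (simp add: osc_phi_def[of "s + 1"])
qed

lemma osc_phi_superlinear: "c > 0 \<Longrightarrow> \<forall>\<^sub>F s in at_top. s \<le> c * osc_phi s"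
proof -
  assume c: "c > 0"
  obtain j where j: "node j \<ge> 1 / c"
    using filterlim_node unfolding filterlim_at_top eventually_sequentially by blast
  \<comment> \<open>From \<open>6 * node j\<close> on, \<open>s - 3 * node j\<close> is at least
    \<open>s / 2\<close>, which the factor 2 in the slope offsets; the rest of the slope is at least
    \<open>1 / c\<close>.\<close>
  have "s \<le> c * osc_phi s" if s: "s \<ge> 6 * node j" for s
  proof -
    have s0: "s \<ge> 0" using s node_ge_1[of j] by simp
    have "1 / c \<le> exp (4 * node j)"
      using j node_ge_1[of j] exp_ge_add_one_self[of "4 * node j"] by linarith
    then have "1 / c * s \<le> exp (4 * node j) * s" using s0 by (intro mult_right_mono)
    also have "\<dots> \<le> exp (4 * node j) * (2 * (s - 3 * node j))"
      using s by (intro mult_left_mono) auto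
    also have "\<dots> \<le> osc_phi s" using osc_phi_ge[of j s] by (simp only: mult.assoc mult.left_commute)
    finally show ?thesis using c by (simp add: field_simps)
  qed
  then show ?thesis by (auto simp: eventually_at_top_linorder)
qed

lemma weight_function_osc_weight: "weight_function osc_weight"
  unfolding weight_function_def
proof (intro conjI)
  show "mono_on {0..} osc_weight"
    by (rule mono_onI) (auto simp: osc_weight_def osc_phi_nonneg intro: osc_phi_mono)
  show "\<forall>t\<ge>0. 0 \<le> osc_weight t" by (simp add: osc_weight_def osc_phi_nonneg)
  show "\<forall>t\<in>{0..1}. osc_weight t = 0" by (simp add: osc_weight_def)
  show "convex_on UNIV (\<lambda>t. osc_weight (exp t))"
    using convex_on_osc_phi by (simp add: osc_weight_exp)
  have cont: "continuous_on UNIV osc_phi"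
    by (rule convex_on_continuous) (auto intro: convex_on_osc_phi)
  have eq: "osc_weight = (\<lambda>t. osc_phi (ln (max 1 t)))"
    by (auto simp: osc_weight_def fun_eq_iff osc_phi_nonpos_arg max_def)
  have "continuous_on {0..} (\<lambda>t::real. osc_phi (ln (max 1 t)))"
    by (intro continuous_on_compose2[OF cont] continuous_intros) auto
  then show "continuous_on {0..} osc_weight" unfolding eq .
  have ln_top: "filterlim ln at_top (at_top :: real filter)" by (rule ln_at_top)
  show "(\<lambda>t. osc_weight (2 * t)) \<in> O[at_top](osc_weight)"
  proof (rule bigoI)
    have "\<forall>\<^sub>F t::real in at_top. ln t \<le> 1 * osc_phi (ln t)"
      using osc_phi_superlinear[of 1] ln_top by (auto simp: filterlim_iff)
    moreover have "\<forall>\<^sub>F t::real in at_top. t \<ge> exp 1" by (rule eventually_ge_at_top)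
    ultimately show "\<forall>\<^sub>F t in at_top. norm (osc_weight (2 * t)) \<le> (2 * exp 2) * norm (osc_weight t)"
    proof eventually_elim
      case (elim t)
      have t: "t > 1" using elim(2) exp_ge_add_one_self[of 1] by linarith
      have "ln t \<ge> 1" using elim(2) t by (simp add: ln_ge_iff)
      \<comment> \<open>This absorbs the additive 1 of \<open>osc_phi_shift\<close>; doubling
        \<open>t\<close> shifts its logarithm by ln 2 \<le> 1.\<close>
      with elim(1) have 1: "1 \<le> osc_phi (ln t)" by simp
      have "ln (2 * t) \<le> ln t + 1" using t ln_add_one_self_le_self[of 1] by (simp add: ln_mult)
      then have "osc_phi (ln (2 * t)) \<le> osc_phi (ln t + 1)" by (rule osc_phi_mono)
      also have "\<dots> \<le> exp 2 * (osc_phi (ln t) + 1)" by (rule osc_phi_shift)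
      also have "\<dots> \<le> exp 2 * (2 * osc_phi (ln t))" using 1 by (intro mult_left_mono) auto
      finally show ?case using t osc_phi_nonneg by (simp add: osc_weight_def)
    qed
  qed
  show "ln \<in> o[at_top](osc_weight)"
  proof (rule landau_o.smallI)
    fix c :: real assume "c > 0"
    then have "\<forall>\<^sub>F t::real in at_top. ln t \<le> c * osc_phi (ln t)"
      using osc_phi_superlinear[of c] ln_top by (auto simp: filterlim_iff)
    moreover have "\<forall>\<^sub>F t::real in at_top. t > 1" by (rule eventually_gt_at_top)
    ultimately show "\<forall>\<^sub>F t in at_top. norm (ln t) \<le> c * norm (osc_weight t)"
      by eventually_elim (auto simp: osc_weight_def osc_phi_nonneg)
  qed
qed

section \<open>Bounds for the Young conjugate\<close>

text \<open>Beyond \<open>3 * node j\<close> the supporting line of \<open>osc_phi_ge\<close> rises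
  at least as fast as \<open>s * t\<close>, so nothing is gained there; before that point
  \<open>osc_phi s\<close> is simply dropped.\<close>

lemma osc_conj_arg_le:
  assumes "s \<ge> 0" "0 \<le> t" "t \<le> 2 * exp (4 * node j)"
  shows "s * t - osc_phi s \<le> 3 * node j * t"
proof (cases "s \<le> 3 * node j")
  case True
  then have "s * t \<le> 3 * node j * t" using assms by (intro mult_right_mono) auto
  then show ?thesis using osc_phi_nonneg[of s] by linarith
next
  case False
  then have "t * (s - 3 * node j) \<le> 2 * exp (4 * node j) * (s - 3 * node j)"
    using assms by (intro mult_right_mono) auto
  also have "\<dots> \<le> osc_phi s" by (rule osc_phi_ge)
  finally show ?thesis by (simp add: algebra_simps)
qed

lemma osc_conj_le:
  assumes "0 \<le> t" "t \<le> 2 * exp (4 * node j)"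
  shows "conj_phi osc_weight t \<le> 3 * node j * t"
  unfolding conj_phi_def osc_weight_exp
  by (rule cSUP_least) (use assms osc_conj_arg_le in auto)

text \<open>\<open>SUP\<close> dominates its terms only if they are bounded above; a node with
  \<open>t \<le> 2 * exp (4 * node j)\<close> supplies the bound.\<close>

lemma osc_conj_ge:
  assumes "s \<ge> 0" "t \<ge> 0"
  shows "s * t - osc_phi s \<le> conj_phi osc_weight t"
proof -
  obtain j where "node j \<ge> t"
    using filterlim_node unfolding filterlim_at_top eventually_sequentially by blast
  then have "t \<le> 2 * exp (4 * node j)"
    using node_ge_1[of j] exp_ge_add_one_self[of "4 * node j"] by linarith
  then have "bdd_above ((\<lambda>s. s * t - osc_phi s) ` {0..})"
    using assms osc_conj_arg_le by (intro bdd_aboveI2[where M = "3 * node j * t"]) auto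
  then show ?thesis
    unfolding conj_phi_def osc_weight_exp using assms by (intro cSUP_upper) auto
qed


section \<open>Taylor's formula and quasianalyticity\<close>

text \<open>Lagrange's remainder around the flat end \<open>b\<close>. It is available for real
  functions, so real and imaginary parts are treated separately, whence the factor 2.\<close>

lemma flat_taylor_bound:
  fixes g :: "nat \<Rightarrow> real \<Rightarrow> complex"
  assumes deriv: "\<And>k t. t \<in> {a..b} \<Longrightarrow> (g k has_vector_derivative g (Suc k) t) (at t)"
    and flat: "\<And>k. g k b = 0"
    and bound: "\<And>t. t \<in> {a..b} \<Longrightarrow> norm (g n t) \<le> B"
    and "a < b"
  shows "norm (g 0 a) \<le> 2 * B * (b - a) ^ n / fact n"
proof -
  have part: "\<bar>p (g 0 a)\<bar> \<le> B * (b - a) ^ n / fact n"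
    if lin: "bounded_linear p" and p: "\<And>z. \<bar>p z\<bar> \<le> norm z" for p :: "complex \<Rightarrow> real"
  proof (cases "n = 0")
    case True
    then show ?thesis using p[of "g 0 a"] bound[of a] \<open>a < b\<close> by simp
  next
    case False
    have "DERIV (\<lambda>t. p (g m t)) t :> p (g (Suc m) t)" if "t \<in> {a..b}" for m t
      using bounded_linear.has_vector_derivative[OF lin deriv[OF that]]
      by (simp add: has_real_derivative_iff_has_vector_derivative)
    then obtain t where t: "a < t" "t < b" and eq:
      "p (g 0 a) = (\<Sum>m<n. (p (g m b) / fact m) * (a - b) ^ m) + p (g n t) / fact n * (a - b) ^ n"
      using Taylor_down[of n "\<lambda>m t. p (g m t)" "\<lambda>t. p (g 0 t)" a b b] False \<open>a < b\<close> by auto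
    have "p 0 = 0" using p[of 0] by simp
    then have "p (g 0 a) = p (g n t) / fact n * (a - b) ^ n" using eq by (simp add: flat)
    then have "\<bar>p (g 0 a)\<bar> = \<bar>p (g n t)\<bar> * (b - a) ^ n / fact n"
      using \<open>a < b\<close> by (simp add: abs_mult power_abs)
    also have "\<dots> \<le> B * (b - a) ^ n / fact n"
      using p[of "g n t"] bound[of t] t \<open>a < b\<close> by (intro divide_right_mono mult_right_mono) auto
    finally show ?thesis .
  qed
  have "\<bar>Re (g 0 a)\<bar> \<le> B * (b - a) ^ n / fact n"
    by (rule part[OF bounded_linear_Re abs_Re_le_cmod])
  moreover have "\<bar>Im (g 0 a)\<bar> \<le> B * (b - a) ^ n / fact n"
    by (rule part[OF bounded_linear_Im abs_Im_le_cmod])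
  moreover have "2 * B * (b - a) ^ n / fact n = B * (b - a) ^ n / fact n + B * (b - a) ^ n / fact n"
    by (simp add: field_simps)
  ultimately show ?thesis using cmod_le[of "g 0 a"] by linarith
qed

text \<open>One term of the exponential series; at \<open>x = n\<close> it is the crude Stirling
  bound (n/e)^n \<le> n!.\<close>

lemma power_div_fact_le_exp:
  fixes x :: real
  assumes "x \<ge> 0"
  shows "x ^ n / fact n \<le> exp x"
proof -
  have "(\<Sum>k\<in>{n}. x ^ k /\<^sub>R fact k) \<le> (\<Sum>k. x ^ k /\<^sub>R fact k)"
    using assms by (intro sum_le_suminf summable_exp_generic) auto
  then show ?thesis by (simp add: exp_def divide_inverse mult.commute)
qed

text \<open>For k \<approx> \<open>2 * exp (4 * node j) / h\<close> the weight is at most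
  \<open>exp (3 * node j) ^ k\<close>, and k! outgrows \<open>(exp (3 * node j) * d) ^ k\<close>
  because k is far larger than \<open>exp (3 * node j)\<close>.\<close>

lemma osc_conj_taylor_zero:
  assumes "h > 0" "d > 0" "C > 0"
    and le: "\<And>k. z \<le> 2 * (C * exp (1 / h * conj_phi osc_weight (h * real k))) * d ^ k / fact k"
  shows "z \<le> 0"
proof (rule ccontr)
  assume "\<not> z \<le> 0"
  then have z: "z > 0" by simp
  \<comment> \<open>Two demands on the node: the first will give
    \<open>exp (3 * node j) * d \<le> k / (2 * exp 1)\<close>, the second
    \<open>2 * C / k < z\<close>.\<close>
  have "\<forall>\<^sub>F x in at_top. 2 * exp (3 * x + 1) * d \<le> 2 * exp (4 * x) / h - 1"
    using assms(1,2) by real_asymp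
  moreover have "\<forall>\<^sub>F x in at_top. 2 * C / z < 2 * exp (4 * x) / h - 1"
    using assms(1) by real_asymp
  ultimately have "\<forall>\<^sub>F j in sequentially. 2 * exp (3 * node j + 1) * d \<le> 2 * exp (4 * node j) / h - 1 \<and>
      2 * C / z < 2 * exp (4 * node j) / h - 1"
    using filterlim_node unfolding filterlim_iff by (auto intro: eventually_conj)
  then obtain j where 1: "2 * exp (3 * node j + 1) * d \<le> 2 * exp (4 * node j) / h - 1"
    and 2: "2 * C / z < 2 * exp (4 * node j) / h - 1"
    by (auto simp: eventually_sequentially)
  \<comment> \<open>Rounding down keeps \<open>h * k\<close> in the range of
    \<open>osc_conj_le\<close>; the loss explains the \<open>- 1\<close> in both demands.\<close>
  define k where "k = nat \<lfloor>2 * exp (4 * node j) / h\<rfloor>"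
  have k: "real k \<le> 2 * exp (4 * node j) / h" "2 * exp (4 * node j) / h - 1 \<le> real k"
    using assms(1) by (auto simp: k_def)
  have kpos: "real k > 0" using 2 k z assms(3) by (smt (verit) divide_pos_pos)
  have "conj_phi osc_weight (h * real k) \<le> 3 * node j * (h * real k)"
    using k(1) assms(1) by (intro osc_conj_le) (auto simp: field_simps)
  then have "1 / h * conj_phi osc_weight (h * real k) \<le> real k * (3 * node j)"
    using assms(1) by (simp add: field_simps)
  then have "exp (1 / h * conj_phi osc_weight (h * real k)) \<le> exp (3 * node j) ^ k"
    by (simp flip: exp_of_nat_mult)
  then have "exp (1 / h * conj_phi osc_weight (h * real k)) * d ^ k \<le> exp (3 * node j) ^ k * d ^ k"
    using assms by (intro mult_right_mono) auto
  also have "\<dots> = (exp (3 * node j) * d) ^ k" by (simp add: power_mult_distrib)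
  also have "\<dots> \<le> (real k / (2 * exp 1)) ^ k"
  proof (rule power_mono)
    have "2 * (exp (3 * node j) * exp 1) * d \<le> real k" using 1 k(2) by (simp add: exp_add)
    then show "exp (3 * node j) * d \<le> real k / (2 * exp 1)" by (simp add: field_simps)
  qed (use assms in auto)
  also have "\<dots> = (1 / 2) ^ k * (real k ^ k / exp (real k))"
    using exp_of_nat_mult[of k "1::real"] by (simp add: power_divide power_mult_distrib)
  also have "\<dots> \<le> (1 / 2) ^ k * fact k"
    using power_div_fact_le_exp[of "real k" k] by (intro mult_left_mono) (auto simp: field_simps)
  finally have A: "exp (1 / h * conj_phi osc_weight (h * real k)) * d ^ k / fact k \<le> (1 / 2) ^ k"
    by (simp add: field_simps)
  have "real k < 2 ^ k" by (rule of_nat_less_two_power)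
  then have "(1 / 2) ^ k \<le> 1 / real k" using kpos by (simp add: power_divide field_simps)
  with A have "exp (1 / h * conj_phi osc_weight (h * real k)) * d ^ k / fact k \<le> 1 / real k"
    by linarith
  then have "2 * C * (exp (1 / h * conj_phi osc_weight (h * real k)) * d ^ k / fact k) \<le> 2 * C * (1 / real k)"
    using assms(3) by (intro mult_left_mono) auto
  then have "z \<le> 2 * C / real k" using le[of k] by (simp add: mult.assoc)
  moreover have "2 * C / z < real k" using 2 k by linarith
  ultimately show False using z kpos by (simp add: field_simps)
qed

text \<open>Quasianalyticity and the failure of inclusion are both tested on these pure derivatives;
  \<open>n \<ge> 1\<close> provides the axis.\<close>

lemma mi_deriv_first_axis:
  assumes "n \<ge> 1"
  shows "mi_deriv n (\<lambda>i. if i = 0 then k else 0) f = (partial_deriv 0 ^^ k) f"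
    and "mi_order n (\<lambda>i. if i = 0 then k else 0) = k"
proof -
  have "foldr (\<lambda>i. partial_deriv i ^^ (if i = 0 then k else 0)) xs f = f" if "0 \<notin> set xs" for xs
    using that by (induction xs) auto
  from this[of "[1..<n]"] show "mi_deriv n (\<lambda>i. if i = 0 then k else 0) f = (partial_deriv 0 ^^ k) f"
    unfolding mi_deriv_def using assms by (simp add: upt_conv_Cons)
  show "mi_order n (\<lambda>i. if i = 0 then k else 0) = k"
    unfolding mi_order_def using assms by (simp add: sum.delta)
qed

lemma foldr_partial_deriv_replicate:
  "foldr partial_deriv (replicate k i) f = (partial_deriv i ^^ k) f"
  by (induction k) auto

lemma continuous_map_line:
  assumes "x \<in> topspace (Euclidean_space n)" "n \<ge> 1"
  shows "continuous_map euclideanreal (Euclidean_space n) (\<lambda>t. x(0 := t))"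
  unfolding Euclidean_space_def continuous_map_in_subtopology continuous_map_componentwise_UNIV
  using assms by (auto simp: topspace_Euclidean_space)

lemma continuous_map_Euclidean_space_coord:
  "continuous_map (Euclidean_space n) euclideanreal (\<lambda>x. x i)"
  unfolding Euclidean_space_def
  by (intro continuous_map_from_subtopology continuous_map_product_projection) auto

text \<open>At the top end of the support along a line in direction 0, all derivatives along that line
  vanish; \<open>flat_taylor_bound\<close> then forces \<open>f\<close> to vanish just below that end.\<close>

lemma quasianalytic_osc_weight:
  assumes n: "n \<ge> 1"
  shows "quasianalytic n (E_fun n osc_weight)"
  unfolding quasianalytic_def
proof (intro allI impI ballI)
  fix \<Omega> f x
  assume op: "openin (Euclidean_space n) \<Omega>" and f: "f \<in> E_fun n osc_weight \<Omega>"
    and supp: "compactly_supported n \<Omega> f" and x: "x \<in> \<Omega>"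
  show "f x = 0"
  proof (rule ccontr)
    assume fx: "f x \<noteq> 0"
    define S where "S = subtopology (Euclidean_space n) \<Omega> closure_of {x \<in> \<Omega>. f x \<noteq> 0}"
    define L where "L t = x(0 := t)" for t
    define T where "T = {t. L t \<in> \<Omega> \<and> f (L t) \<noteq> 0}"
    have \<Omega>: "\<Omega> \<subseteq> topspace (Euclidean_space n)" by (rule openin_subset[OF op])
    have L: "continuous_map euclideanreal (Euclidean_space n) L"
      unfolding L_def using continuous_map_line n x \<Omega> by blast
    have compS: "compactin (Euclidean_space n) S"
      using supp unfolding compactly_supported_def S_def .
    have S\<Omega>: "S \<subseteq> \<Omega>" unfolding S_def using closure_of_subset_topspace by fastforce
    have supS: "{x \<in> \<Omega>. f x \<noteq> 0} \<subseteq> S"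
      unfolding S_def using \<Omega> by (intro closure_of_subset) auto
    have TS: "T \<subseteq> (\<lambda>y. y 0) ` S"
    proof
      fix t assume "t \<in> T"
      then have "L t \<in> S" using supS by (auto simp: T_def)
      then show "t \<in> (\<lambda>y. y 0) ` S"
        using image_eqI[of t "\<lambda>y. y 0" "L t" S] by (simp add: L_def)
    qed
    have "compact ((\<lambda>y. y 0) ` S)"
      using image_compactin[OF compS continuous_map_Euclidean_space_coord] by simp
    then have bdd: "bdd_above T"
      using TS by (meson bdd_above_mono bounded_imp_bdd_above compact_imp_bounded)
    have "x 0 \<in> T" using x fx by (simp add: T_def L_def)
    then have ne: "T \<noteq> {}" by auto
    define b where "b = Sup T"
    \<comment> \<open>\<open>S\<close> is a closure relative to \<Omega>; compactness makes it
      closed in the whole space, so the end point \<open>L b\<close> still lies in \<Omega>.\<close>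
    have "closedin (Euclidean_space n) S"
      by (rule compactin_imp_closedin[OF Hausdorff_Euclidean_space compS])
    then have "closed {t. L t \<in> S}"
      using closedin_continuous_map_preimage[OF L] by simp
    moreover have "T \<subseteq> {t. L t \<in> S}" using supS by (auto simp: T_def)
    ultimately have "b \<in> {t. L t \<in> S}"
      unfolding b_def using closure_contains_Sup[OF ne bdd] closure_minimal by blast
    then have "L b \<in> \<Omega>" using S\<Omega> by auto
    moreover have "open {t. L t \<in> \<Omega>}"
      using openin_continuous_map_preimage[OF L op] by simp
    ultimately obtain e where e: "e > 0" "cball b e \<subseteq> {t. L t \<in> \<Omega>}"
      by (auto simp: open_contains_cball)
    then have L\<Omega>: "L t \<in> \<Omega>" if "b - e \<le> t" "t \<le> b + e" for t
      using that by (auto simp: subset_eq dist_real_def)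
    define g where "g k t = (partial_deriv 0 ^^ k) f (L t)" for k t
    have smooth: "smooth_on_open n \<Omega> f"
      and est: "\<And>K. compactin (Euclidean_space n) K \<Longrightarrow> K \<subseteq> \<Omega> \<Longrightarrow>
        \<exists>C>0. \<exists>h>0. \<forall>\<alpha>. \<forall>x\<in>K. norm (mi_deriv n \<alpha> f x)
          \<le> C * exp (1 / h * conj_phi osc_weight (h * real (mi_order n \<alpha>)))"
      using f unfolding E_fun_def roumieu_class_def by auto
    have deriv: "(g k has_vector_derivative g (Suc k) t) (at t)" if "L t \<in> \<Omega>" for k t
    proof -
      have "(\<lambda>s. foldr partial_deriv (replicate k 0) f ((L t)(0 := s))) differentiable (at (L t 0))"
        using smooth that n unfolding smooth_on_open_def
        by (auto dest!: spec[of _ "replicate k 0"])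
      then have "g k differentiable (at t)"
        unfolding foldr_partial_deriv_replicate g_def by (simp add: L_def)
      moreover have "vector_derivative (g k) (at t) = g (Suc k) t"
        by (simp add: g_def[abs_def] partial_deriv_def L_def)
      ultimately show ?thesis by (metis vector_derivative_works)
    qed
    \<comment> \<open>Derivatives are local, so vanishing to the right of \<open>b\<close> passes to
      every order; continuity then carries it to \<open>b\<close>.\<close>
    have zero_right: "g k t = 0" if "b < t" "t < b + e" for k t
      using that
    proof (induction k arbitrary: t)
      case 0
      have "t \<notin> T" using 0 cSup_upper[OF _ bdd] by (force simp: b_def)
      then show ?case using L\<Omega>[of t] 0 e by (simp add: T_def g_def)
    next
      case (Suc k)
      have "((\<lambda>_. 0) has_vector_derivative g (Suc k) t) (at t)"
        by (rule has_vector_derivative_transform_within_open[of "g k" _ _ "{b<..<b + e}"])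
           (use Suc e deriv L\<Omega> in auto)
      then show ?case using vector_derivative_at by (fastforce simp: vector_derivative_const_at)
    qed
    have flat: "g k b = 0" for k
    proof (rule continuous_constant_on_closure[of "{b<..<b + e}" "g k"])
      have "continuous (at t) (g k)" if "t \<in> {b..b + e}" for t
        using deriv[of t k] L\<Omega>[of t] that e has_vector_derivative_continuous by auto
      then have "continuous_on {b..b + e} (g k)" by (intro continuous_at_imp_continuous_on) auto
      then show "continuous_on (closure {b<..<b + e}) (g k)" using e by simp
    qed (use zero_right e in auto)
    \<comment> \<open>One compact segment gives \<open>C\<close> and \<open>h\<close> valid for all
      orders at once.\<close>
    define K where "K = L ` {b - e..b}"
    have "compactin (Euclidean_space n) K"
      unfolding K_def by (rule image_compactin[OF _ L]) auto
    moreover have "K \<subseteq> \<Omega>" using L\<Omega> e by (auto simp: K_def)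
    ultimately obtain C h where C: "C > 0" "h > 0" and bd: "\<And>\<alpha> y. y \<in> K \<Longrightarrow> norm (mi_deriv n \<alpha> f y)
          \<le> C * exp (1 / h * conj_phi osc_weight (h * real (mi_order n \<alpha>)))"
      using est by blast
    have gbd: "norm (g k t) \<le> C * exp (1 / h * conj_phi osc_weight (h * real k))"
      if "t \<in> {b - e..b}" for k t
      using bd[of "L t" "\<lambda>i. if i = 0 then k else 0"] that
      unfolding mi_deriv_first_axis[OF n] by (simp add: K_def g_def)
    have zero_left: "f (L a) = 0" if a: "b - e \<le> a" "a < b" for a
    proof -
      have "norm (g 0 a) \<le> 2 * (C * exp (1 / h * conj_phi osc_weight (h * real k))) * (b - a) ^ k / fact k" for k
        by (rule flat_taylor_bound) (use a deriv flat gbd L\<Omega> e in auto)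
      then have "norm (g 0 a) \<le> 0"
        using osc_conj_taylor_zero[of h "b - a" C "norm (g 0 a)"] C a by auto
      then show ?thesis by (simp add: g_def)
    qed
    \<comment> \<open>The supremum of \<open>T\<close> has points of \<open>T\<close> in every left
      neighbourhood; \<open>t = b\<close> is excluded by \<open>flat\<close>, \<open>t < b\<close>
      by \<open>zero_left\<close>.\<close>
    obtain t where t: "t \<in> T" "b - e < t"
      using less_cSup_iff[OF ne bdd, of "b - e"] e by (auto simp: b_def)
    have "t \<le> b" using t cSup_upper[OF _ bdd] by (simp add: b_def)
    then have "f (L t) = 0" using zero_left[of t] flat[of 0] t by (cases "t = b") (auto simp: g_def)
    then show False using t by (simp add: T_def)
  qed
qed

section \<open>The lacunary series and its derivatives\<close>

text \<open>The \<open>k\<close>-th derivative of the \<open>j\<close>-th term in closed form, so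
  that differentiating only raises \<open>k\<close>.\<close>

definition wave_term :: "nat \<Rightarrow> nat \<Rightarrow> real \<Rightarrow> complex" where
  "wave_term k j t = of_real ((1/2) ^ j * exp (- osc_phi (node j))) *
     (\<i> * of_real (exp (node j))) ^ k * exp (t *\<^sub>R (\<i> * of_real (exp (node j))))"

definition wave :: "nat \<Rightarrow> real \<Rightarrow> complex" where
  "wave k t = (\<Sum>j. wave_term k j t)"

lemma wave_term_has_vector_derivative:
  "(wave_term k j has_vector_derivative wave_term (Suc k) j t) (at t)"
  unfolding wave_term_def
  by (rule has_vector_derivative_eq_rhs,
      rule has_vector_derivative_mult_right[OF exp_scaleR_has_vector_derivative_right])
     (simp add: mult_ac)

lemma norm_wave_term:
  "norm (wave_term k j t) = (1/2) ^ j * exp (node j * real k - osc_phi (node j))"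
proof -
  have "norm (exp (t *\<^sub>R (\<i> * complex_of_real (exp (node j))))) = 1"
    by simp
  then show ?thesis
    by (simp add: wave_term_def norm_mult norm_power norm_divide flip: exp_of_nat_mult exp_add)
qed

text \<open>The exponent is a competitor, at \<open>s = node j\<close>, in the supremum defining the
  conjugate at \<open>k\<close>.\<close>

lemma norm_wave_term_le:
  "norm (wave_term k j t) \<le> (1/2) ^ j * exp (conj_phi osc_weight (real k))"
  unfolding norm_wave_term using node_ge_1[of j]
  by (intro mult_left_mono) (auto intro!: osc_conj_ge)

lemma summable_wave_bound: "summable (\<lambda>j. (1/2) ^ j * c :: real)"
  by (intro summable_mult2 summable_geometric) auto

lemma summable_norm_wave_term: "summable (\<lambda>j. norm (wave_term k j t))"
  by (rule summable_comparison_test'[OF summable_wave_bound[of "exp (conj_phi osc_weight (real k))"]])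
     (simp add: norm_wave_term_le)

lemma summable_wave_term: "summable (\<lambda>j. wave_term k j t)"
  by (rule summable_norm_cancel[OF summable_norm_wave_term])

lemma norm_wave_le: "norm (wave k t) \<le> 2 * exp (conj_phi osc_weight (real k))"
proof -
  have "norm (wave k t) \<le> (\<Sum>j. (1/2) ^ j * exp (conj_phi osc_weight (real k)))"
    unfolding wave_def by (rule norm_suminf_le[OF norm_wave_term_le summable_wave_bound])
  also have "\<dots> = 2 * exp (conj_phi osc_weight (real k))"
    using suminf_geometric[of "1/2::real"] by (subst suminf_mult2[symmetric]) auto
  finally show ?thesis .
qed

text \<open>The series of next derivatives converges uniformly by the M-test, which permits termwise
  differentiation.\<close>

lemma wave_has_vector_derivative: "(wave k has_vector_derivative wave (Suc k) t) (at t)"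
proof -
  have unif: "uniform_limit UNIV (\<lambda>n x. \<Sum>i<n. wave_term (Suc k) i x) (wave (Suc k)) sequentially"
    unfolding wave_def
    by (rule Weierstrass_m_test[OF norm_wave_term_le summable_wave_bound])
  have "\<exists>g. \<forall>x\<in>UNIV. (\<lambda>n. wave_term k n x) sums g x \<and>
      (g has_derivative (\<lambda>h. h *\<^sub>R wave (Suc k) x)) (at x within UNIV)"
  proof (rule has_derivative_series)
    show "(wave_term k n has_derivative (\<lambda>h. h *\<^sub>R wave_term (Suc k) n x)) (at x within UNIV)" for n x
      using wave_term_has_vector_derivative[of k n x] by (simp add: has_vector_derivative_def)
    show "(\<lambda>n. wave_term k n 0) sums wave k 0"
      unfolding wave_def by (rule summable_sums[OF summable_wave_term])
    fix e :: real assume "e > 0"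
    then have "\<forall>\<^sub>F n in sequentially. \<forall>x\<in>UNIV. dist (\<Sum>i<n. wave_term (Suc k) i x) (wave (Suc k) x) < e"
      using unif by (auto simp: uniform_limit_iff)
    then show "\<forall>\<^sub>F n in sequentially. \<forall>x\<in>UNIV. \<forall>h.
        norm ((\<Sum>i<n. h *\<^sub>R wave_term (Suc k) i x) - h *\<^sub>R wave (Suc k) x) \<le> e * norm h"
    proof eventually_elim
      case (elim n)
      show ?case
      proof (intro ballI allI)
        fix x h :: real
        have "(\<Sum>i<n. h *\<^sub>R wave_term (Suc k) i x) - h *\<^sub>R wave (Suc k) x
            = h *\<^sub>R ((\<Sum>i<n. wave_term (Suc k) i x) - wave (Suc k) x)"
          by (simp add: scaleR_sum_right scaleR_diff_right)
        then show "norm ((\<Sum>i<n. h *\<^sub>R wave_term (Suc k) i x) - h *\<^sub>R wave (Suc k) x) \<le> e * norm h"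
          using mult_left_mono[of "norm ((\<Sum>i<n. wave_term (Suc k) i x) - wave (Suc k) x)" e "\<bar>h\<bar>"] elim
          by (auto simp: dist_norm mult.commute[of e] less_imp_le)
      qed
    qed
  qed auto
  then obtain g where g: "\<And>x. (\<lambda>n. wave_term k n x) sums g x"
      "\<And>x. (g has_derivative (\<lambda>h. h *\<^sub>R wave (Suc k) x)) (at x)" by auto
  have "g = wave k" using g(1) sums_unique by (fastforce simp: wave_def)
  then show ?thesis using g(2) by (simp add: has_vector_derivative_def)
qed

text \<open>At 0 all terms share the phase \<open>\<i> ^ k\<close>, so nothing cancels and the sum
  dominates each term.\<close>

lemma norm_wave_zero_ge:
  "(1/2) ^ j * exp (node j * real k - osc_phi (node j)) \<le> norm (wave k 0)"
proof -
  define r where "r j = (1/2) ^ j * exp (- osc_phi (node j)) * exp (node j) ^ k" for j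
  have r: "wave_term k j 0 = \<i> ^ k * of_real (r j)" for j
    by (simp add: wave_term_def r_def power_mult_distrib)
  have nr: "norm (wave_term k j 0) = r j" for j
    unfolding r by (simp add: norm_mult norm_power r_def)
  have sr: "summable r" using summable_norm_wave_term[of k 0] by (simp add: nr)
  have "wave k 0 = \<i> ^ k * of_real (suminf r)"
    unfolding wave_def r suminf_of_real[OF sr]
    by (rule suminf_mult) (use sr in \<open>simp add: summable_of_real\<close>)
  then have "norm (wave k 0) = \<bar>suminf r\<bar>" by (simp add: norm_mult norm_power)
  moreover have "r j \<le> suminf r"
    using sum_le_suminf[OF sr, of "{j}"] by (simp add: r_def)
  ultimately show ?thesis using nr[of j] norm_wave_term[of k j 0] by simp
qed

text \<open>Depending on the first coordinate only, one function serves every dimension.\<close>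

definition wave_fun :: "pt \<Rightarrow> complex" where
  "wave_fun x = wave 0 (x 0)"

text \<open>A single differentiation in another direction yields 0, and later ones keep it.\<close>

lemma foldr_partial_deriv_wave_fun:
  "foldr partial_deriv is wave_fun =
     (\<lambda>x. if set is \<subseteq> {0} then wave (length is) (x 0) else 0)"
proof (induction "is")
  case Nil
  then show ?case by (simp add: wave_fun_def fun_eq_iff)
next
  case (Cons i js)
  show ?case
  proof (cases "i = 0")
    case True
    then show ?thesis
      using wave_has_vector_derivative[of "length js", THEN vector_derivative_at]
      unfolding foldr.simps o_apply Cons by (auto simp: partial_deriv_def fun_eq_iff)
  next
    case False
    then have "(\<lambda>t. foldr partial_deriv js wave_fun (x(i := t))) = (\<lambda>t. foldr partial_deriv js wave_fun x)" for x
      unfolding Cons by simp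
    then have "partial_deriv i (foldr partial_deriv js wave_fun) x = 0" for x
      unfolding partial_deriv_def[of i "foldr partial_deriv js wave_fun"] by simp
    then show ?thesis using False by (simp add: fun_eq_iff)
  qed
qed

lemma foldr_funpow_conv_concat:
  "foldr (\<lambda>i. F i ^^ \<alpha> i) xs f = foldr F (concat (map (\<lambda>i. replicate (\<alpha> i) i) xs)) f"
proof (induction xs)
  case (Cons i xs)
  have "foldr F (replicate m i) g = (F i ^^ m) g" for m g by (induction m) auto
  with Cons show ?case by simp
qed simp

lemma norm_mi_deriv_wave_fun:
  "norm (mi_deriv n \<alpha> wave_fun x) \<le> 2 * exp (conj_phi osc_weight (real (mi_order n \<alpha>)))"
proof -
  define js where "js = concat (map (\<lambda>i. replicate (\<alpha> i) i) [0..<n])"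
  have len: "length js = mi_order n \<alpha>"
    by (simp add: js_def mi_order_def length_concat comp_def sum_list_distinct_conv_sum_set atLeast0LessThan)
  have "mi_deriv n \<alpha> wave_fun = foldr partial_deriv js wave_fun"
    unfolding mi_deriv_def js_def by (rule foldr_funpow_conv_concat)
  then show ?thesis
    using norm_wave_le[of "mi_order n \<alpha>" "x 0"] by (simp add: foldr_partial_deriv_wave_fun len)
qed

lemma smooth_wave_fun: "smooth_on_open n \<Omega> wave_fun"
  unfolding smooth_on_open_def foldr_partial_deriv_wave_fun
proof (intro allI impI conjI ballI)
  have diff: "wave k differentiable (at t)" for k t
    using wave_has_vector_derivative[of k t] by (rule differentiableI_vector)
  then have "continuous_on UNIV (wave k)" for k
    by (meson continuous_at_imp_continuous_on differentiable_imp_continuous_within)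
  then have "continuous_map (subtopology (Euclidean_space n) \<Omega>) euclidean (wave k \<circ> (\<lambda>x. x 0))" for k
    by (intro continuous_map_compose[of _ euclideanreal] continuous_map_from_subtopology
        continuous_map_Euclidean_space_coord) simp
  then show "continuous_map (subtopology (Euclidean_space n) \<Omega>) euclidean
      (\<lambda>x. if set is \<subseteq> {0} then wave (length is) (x 0) else 0)" for "is"
    by (simp add: comp_def)
  show "(\<lambda>t. if set is \<subseteq> {0} then wave (length is) ((x(i := t)) 0) else 0) differentiable (at (x i))"
    for "is" i and x :: pt
    using diff[of "length is" "x i"] by (cases "i = 0"; cases "set is \<subseteq> {0}") simp_all
qed

lemma wave_fun_in_E_fun: "wave_fun \<in> E_fun n osc_weight \<Omega>"
  unfolding E_fun_def roumieu_class_def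
proof (intro CollectI conjI allI impI smooth_wave_fun)
  \<comment> \<open>\<open>C = 2\<close> and \<open>h = 1\<close> serve every compact set, the bound
    being global.\<close>
  show "\<exists>C>0. \<exists>h>0. \<forall>\<alpha>. \<forall>x\<in>K. norm (mi_deriv n \<alpha> wave_fun x)
      \<le> C * exp (1 / h * conj_phi osc_weight (h * real (mi_order n \<alpha>)))" for K
    using norm_mi_deriv_wave_fun
    by (intro exI[of _ "2::real"] exI[of _ "1::real"] conjI allI ballI) auto
qed

section \<open>Failure of the inclusion\<close>

text \<open>Iteration gives the exponent k(k+1)/2 \<le> k^2; the base \<open>max 1 Q\<close> permits
  enlarging exponents.\<close>

lemma semiregular_growth:
  assumes "weight_sequence M" "semiregular M"
  shows "\<exists>Q\<ge>1. \<forall>k. M k \<le> Q ^ (k\<^sup>2)"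
proof -
  obtain Q where Q: "Q > 0" "\<And>k. M (k + 1) \<le> Q ^ (k + 1) * M k"
    using assms(2) by (auto simp: semiregular_def)
  have M: "M 0 = 1" "\<And>k. M k > 0" using assms(1) by (auto simp: weight_sequence_def)
  have "M k \<le> max 1 Q ^ (k\<^sup>2)" for k
  proof (induction k)
    case (Suc k)
    have "M (Suc k) \<le> Q ^ (k + 1) * M k" using Q(2)[of k] by simp
    also have "\<dots> \<le> max 1 Q ^ (k + 1) * max 1 Q ^ (k\<^sup>2)"
      using Q(1) M(2)[of k] Suc by (intro mult_mono power_mono) (auto intro: less_imp_le)
    also have "\<dots> \<le> max 1 Q ^ ((Suc k)\<^sup>2)"
      unfolding power_add[symmetric] by (intro power_increasing) (auto simp: power2_eq_square)
    finally show ?case .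
  qed (simp add: M)
  then show ?thesis by (intro exI[of _ "max 1 Q"]) auto
qed

lemma wave_fun_notin_E_seq:
  assumes M: "weight_sequence M" "semiregular M" and n: "n \<ge> 1"
  shows "wave_fun \<notin> E_seq n M (topspace (Euclidean_space n))"
proof
  assume "wave_fun \<in> E_seq n M (topspace (Euclidean_space n))"
  moreover have "compactin (Euclidean_space n) {\<lambda>_. 0}"
    by (simp add: topspace_Euclidean_space)
  ultimately obtain C h where C: "C > 0" "h > 0" and
    bd: "\<And>\<alpha>. norm (mi_deriv n \<alpha> wave_fun (\<lambda>_. 0)) \<le> C * (h ^ mi_order n \<alpha> * M (mi_order n \<alpha>))"
    unfolding E_seq_def roumieu_class_def
    by (auto simp: topspace_Euclidean_space dest!: spec[of _ "{\<lambda>_. 0}"])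
  obtain Q where Q: "Q \<ge> 1" "\<And>k. M k \<le> Q ^ (k\<^sup>2)" using semiregular_growth[OF M] by auto
  have "norm (wave k 0) \<le> C * (h ^ k * M k)" for k
    using bd[of "\<lambda>i. if i = 0 then k else 0"] foldr_partial_deriv_wave_fun[of "replicate k 0"]
    unfolding mi_deriv_first_axis[OF n] foldr_partial_deriv_replicate
    by (simp add: set_replicate_conv_if split: if_splits)
  also have "C * (h ^ k * M k) \<le> C * (h ^ k * Q ^ (k\<^sup>2))" for k
    using Q C by (intro mult_left_mono) auto
  finally have up: "norm (wave k 0) \<le> C * (h ^ k * Q ^ (k\<^sup>2))" for k .
  \<comment> \<open>The lower and upper bounds at the origin after taking logarithms; the summand
    \<open>node j\<close> absorbs \<open>j * ln 2\<close> from the factor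
    \<open>(1/2) ^ j\<close>.\<close>
  have key: "real k * node j \<le> 4 * node j powr (3/2) + node j + \<bar>ln C\<bar> + real k * \<bar>ln h\<bar> + (real k)\<^sup>2 * ln Q"
    for k j
  proof -
    have "(1/2) ^ j * exp (node j * real k - osc_phi (node j)) \<le> C * (h ^ k * Q ^ (k\<^sup>2))"
      using norm_wave_zero_ge up by (rule order.trans)
    then have "ln ((1/2) ^ j * exp (node j * real k - osc_phi (node j))) \<le> ln (C * (h ^ k * Q ^ (k\<^sup>2)))"
      using C Q by (subst ln_le_cancel_iff) auto
    then have "node j * real k - osc_phi (node j) - real j * ln 2
        \<le> ln C + real k * ln h + (real k)\<^sup>2 * ln Q"
      using C Q by (simp add: ln_mult ln_realpow ln_div)
    moreover have "real k * ln h \<le> real k * \<bar>ln h\<bar>" by (intro mult_left_mono) auto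
    moreover have "real j * ln 2 \<le> node j"
      using mult_left_mono[of "ln 2" 1 "real j"] ln_2_less_1 node_ge[of j] by simp
    ultimately show ?thesis using osc_phi_node_le[of j] by (simp add: mult.commute[of "node j"])
  qed
  define A where "A = \<bar>ln C\<bar>"
  define B where "B = \<bar>ln h\<bar>"
  define D where "D = ln Q"
  have nonneg: "A \<ge> 0" "B \<ge> 0" "D \<ge> 0" using Q by (auto simp: A_def B_def D_def)
  \<comment> \<open>The right side has order a^(7/4), each term on the left at most a^(3/2); the
    \<open>- 1\<close> allows for rounding in \<open>k\<close>.\<close>
  have "\<forall>\<^sub>F a::real in at_top. 4 * a powr (3/2) + a + A + a powr (3/4) * B + a powr (3/2) * D
      < (a powr (3/4) - 1) * a"
    by real_asymp
  then have "\<forall>\<^sub>F j in sequentially. 4 * node j powr (3/2) + node j + A + node j powr (3/4) * B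
      + node j powr (3/2) * D < (node j powr (3/4) - 1) * node j"
    using filterlim_node by (auto simp: filterlim_iff)
  then obtain j where j: "4 * node j powr (3/2) + node j + A + node j powr (3/4) * B
      + node j powr (3/2) * D < (node j powr (3/4) - 1) * node j"
    by (auto simp: eventually_sequentially)
  define k where "k = nat \<lfloor>node j powr (3/4)\<rfloor>"
  have k: "real k \<le> node j powr (3/4)" "node j powr (3/4) - 1 \<le> real k" by (auto simp: k_def)
  have "(node j powr (3/4) - 1) * node j \<le> real k * node j"
    using k node_ge_1[of j] by (intro mult_right_mono) auto
  also have "\<dots> \<le> 4 * node j powr (3/2) + node j + A + real k * B + (real k)\<^sup>2 * D"
    using key[of k j] by (simp add: A_def B_def D_def)
  also have "(real k)\<^sup>2 \<le> (node j powr (3/4))\<^sup>2" using k by (intro power_mono) auto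
  also have "(node j powr (3/4))\<^sup>2 = node j powr (3/2)"
    by (simp add: power2_eq_square flip: powr_add)
  also have "real k \<le> node j powr (3/4)" by (rule k)
  finally show False using j nonneg by (simp add: mult_right_mono)
qed

theorem corollaryB2:
  shows "\<exists>\<omega>. weight_function \<omega> \<and>
     (\<forall>n\<ge>1. quasianalytic n (E_fun n \<omega>)) \<and>
     (\<forall>M. weight_sequence M \<and> semiregular M \<longrightarrow>
        (\<forall>n\<ge>1. \<not> subsheaf n (E_fun n \<omega>) (E_seq n M)))"
proof (intro exI[of _ osc_weight] conjI allI impI)
  show "weight_function osc_weight" by (rule weight_function_osc_weight)
  show "quasianalytic n (E_fun n osc_weight)" if "n \<ge> 1" for n
    using that by (rule quasianalytic_osc_weight)
  \<comment> \<open>Inclusion fails already over the whole space, with a witness depending neither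
    on \<open>M\<close> nor on \<open>n\<close>.\<close>
  show "\<not> subsheaf n (E_fun n osc_weight) (E_seq n M)"
    if "weight_sequence M \<and> semiregular M" "n \<ge> 1" for M n
    unfolding subsheaf_def
    using that wave_fun_notin_E_seq wave_fun_in_E_fun openin_topspace by blast
qed

end
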